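(* Let $\mathcal{F}=\{f_i:i\in I\}$, $I=\{1,\ldots,k\}$, be an iterated function system on a complete metric space $X$, with attractor $K$. Let $c_i\in(0,1)$ be the similarity factor of the similarity $f_i$ for each $i\in I$, and let $\mathbf{\Gamma}$ be the natural fractal structure on $K$ as a self-similar set. Then the fractal dimension III of $K$ satisfies $\dim_{\mathbf{\Gamma}}^3(K)=s$, where $s$ is the solution of the equation $$\sum_{i\in I}c_i^s=1.$$ Moreover, for that value of $s$, $\mathcal{H}_3^s(K)\in(0,\infty)$.
   Context: A similarity on a metric space $(X,\rho)$ with similarity factor $c>0$ is a map $f:X\to X$ with $\rho(f(x),f(y))=c\,\rho(x,y)$ for all $x,y\in X$. An iterated function system (IFS) is a finite family $\mathcal{F}=\{f_i:i\in I\}$, $I=\{1,\ldots,k\}$, of (contractive) similarities. Its attractor (self-similar set) is the unique non-empty compact set $K\subset X$ with $K=\bigcup_{i\in I}f_i(K)$. A fractal structure on a set $X$ is a countable family $\mathbf{\Gamma}=\{\Gamma_n:n\in\mathbb{N}\}$ of coverings of $X$ (called levels) such that for all $n$: every $A\in\Gamma_{n+1}$ is contained in some $B\in\Gamma_n$, and every $B\in\Gamma_n$ satisfies $B=\bigcup\{A\in\Gamma_{n+1}:A\subseteq B\}$. A set is allowed to appear more than once in a level (levels are families counted with multiplicity). The natural fractal structure on the attractor $K$ has levels $\Gamma_n=\{f_\omega(K):\omega\in I^n\}$, where $f_\omega=f_{\omega_1}\circ\cdots\circ f_{\omega_n}$ for $\omega=\omega_1\ldots\omega_n$; the family is indexed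 by words $\omega\in I^n$, so sums over $\Gamma_n$ are sums over words, with multiplicity. Fractal dimension III: let $\mathbf{\Gamma}$ be a fractal structure on a metric space, $F$ a subset, and assume $\delta(F,\Gamma_n)=\sup\{\operatorname{diam}(A):A\in\Gamma_n,\ A\cap F\neq\emptyset\}\to0$. For $n\in\mathbb{N}$ and $s\ge0$ put $$\mathcal{H}_{n,3}^s(F)=\inf\Big\{\sum_{A\in\Gamma_l,\ A\cap F\neq\emptyset}\operatorname{diam}(A)^s : l\geq n\Big\},\qquad \mathcal{H}_3^s(F)=\lim_{n\to\infty}\mathcal{H}_{n,3}^s(F),$$ and define $\dim_{\mathbf{\Gamma}}^3(F)=\inf\{s:\mathcal{H}_3^s(F)=0\}=\sup\{s:\mathcal{H}_3^s(F)=\infty\}$.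
   Formalization: The attractor K is additionally assumed not to be a single point when k ≥ 2; otherwise the claim fails, e.g. for x/2 and x/3 on the real line, where K={0} has dimension 0 but s>0. *)

theory Defs
  imports "HOL-Analysis.Analysis"
begin

definition similarity :: "real \<Rightarrow> ('a::metric_space \<Rightarrow> 'a) \<Rightarrow> bool" where
  "similarity c f \<longleftrightarrow> c > 0 \<and> (\<forall>x y. dist (f x) (f y) = c * dist x y)"

definition contractive_ifs :: "nat \<Rightarrow> (nat \<Rightarrow> 'a::metric_space \<Rightarrow> 'a) \<Rightarrow> (nat \<Rightarrow> real) \<Rightarrow> bool" where
  "contractive_ifs k f c \<longleftrightarrow> (\<forall>i\<in>{1..k}. c i < 1 \<and> similarity (c i) (f i))"

definition is_attractor :: "nat \<Rightarrow> (nat \<Rightarrow> 'a::metric_space \<Rightarrow> 'a) \<Rightarrow> 'a set \<Rightarrow> bool" where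
  "is_attractor k f K \<longleftrightarrow> K \<noteq> {} \<and> compact K \<and> K = (\<Union>i\<in>{1..k}. f i ` K)"

text \<open>
  A level of a fractal structure is a family of sets counted with multiplicity: a pair of an
  index set and the set attached to each index.
\<close>

type_synonym ('i, 'a) level = "'i set \<times> ('i \<Rightarrow> 'a set)"

definition elems :: "('i, 'a) level \<Rightarrow> 'a set set" where
  "elems L = snd L ` fst L"

definition fractal_structure :: "'a set \<Rightarrow> (nat \<Rightarrow> ('i, 'a) level) \<Rightarrow> bool" where
  "fractal_structure X \<Gamma> \<longleftrightarrow> (\<forall>n.
     \<Union>(elems (\<Gamma> n)) = X \<and>
     (\<forall>A\<in>elems (\<Gamma> (Suc n)). \<exists>B\<in>elems (\<Gamma> n). A \<subseteq> B) \<and>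
     (\<forall>B\<in>elems (\<Gamma> n). B = \<Union>{A \<in> elems (\<Gamma> (Suc n)). A \<subseteq> B}))"

primrec word_map :: "('i \<Rightarrow> 'a \<Rightarrow> 'a) \<Rightarrow> 'i list \<Rightarrow> 'a \<Rightarrow> 'a" where
  "word_map f [] = id"
| "word_map f (i # w) = f i \<circ> word_map f w"

definition natural_fractal_structure ::
  "nat \<Rightarrow> (nat \<Rightarrow> 'a \<Rightarrow> 'a) \<Rightarrow> 'a set \<Rightarrow> nat \<Rightarrow> (nat list, 'a) level" where
  "natural_fractal_structure k f K n =
     ({w. length w = n \<and> set w \<subseteq> {1..k}}, \<lambda>w. word_map f w ` K)"

text \<open>
  The library's \<^const>\<open>diameter\<close> is real-valued and meaningful for bounded sets only;
  unbounded sets get diameter \<open>\<infinity>\<close> here. The convention \<open>diam(A)\<^sup>0 = 1\<close> is used for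
  every \<open>A\<close>, including sets of diameter \<open>0\<close> (whereas \<open>0 powr 0 = 0\<close> in the library), so that
  exponent \<open>0\<close> counts the elements of a level.
\<close>

definition ediam :: "'a::metric_space set \<Rightarrow> ennreal" where
  "ediam A = (if bounded A then ennreal (diameter A) else \<infinity>)"

definition diam_pow :: "real \<Rightarrow> 'a::metric_space set \<Rightarrow> ennreal" where
  "diam_pow s A =
     (if s = 0 then 1 else if bounded A then ennreal (diameter A powr s) else \<infinity>)"

definition mesh :: "'a::metric_space set \<Rightarrow> ('i, 'a) level \<Rightarrow> ennreal" where
  "mesh F L = (SUP A\<in>{A \<in> elems L. A \<inter> F \<noteq> {}}. ediam A)"

definition level_sum :: "real \<Rightarrow> 'a::metric_space set \<Rightarrow> ('i, 'a) level \<Rightarrow> ennreal" where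
  "level_sum s F L = (\<Sum>\<^sub>\<infinity>i\<in>{i \<in> fst L. snd L i \<inter> F \<noteq> {}}. diam_pow s (snd L i))"

definition H3_pre ::
  "(nat \<Rightarrow> ('i, 'a::metric_space) level) \<Rightarrow> nat \<Rightarrow> real \<Rightarrow> 'a set \<Rightarrow> ennreal" where
  "H3_pre \<Gamma> n s F = (INF l\<in>{n..}. level_sum s F (\<Gamma> l))"

definition H3 :: "(nat \<Rightarrow> ('i, 'a::metric_space) level) \<Rightarrow> real \<Rightarrow> 'a set \<Rightarrow> ennreal" where
  "H3 \<Gamma> s F = lim (\<lambda>n. H3_pre \<Gamma> n s F)"

text \<open>
  Intended for \<open>mesh F (\<Gamma> n) \<longlonglongrightarrow> 0\<close>; then the infimum equals the supremum of the exponents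
  with infinite measure, see \<open>dim3_eq_Sup\<close>.
\<close>

definition dim3 :: "(nat \<Rightarrow> ('i, 'a::metric_space) level) \<Rightarrow> 'a set \<Rightarrow> ennreal" where
  "dim3 \<Gamma> F = Inf {ennreal s |s. 0 \<le> s \<and> H3 \<Gamma> s F = 0}"

lemma H3_tendsto: "(\<lambda>n. H3_pre \<Gamma> n s F) \<longlonglongrightarrow> H3 \<Gamma> s F"
proof -
  have "incseq (\<lambda>n. H3_pre \<Gamma> n s F)"
    unfolding H3_pre_def by (intro monoI INF_superset_mono) auto
  then have "(\<lambda>n. H3_pre \<Gamma> n s F) \<longlonglongrightarrow> (SUP n. H3_pre \<Gamma> n s F)"
    by (rule LIMSEQ_SUP)
  then show ?thesis
    unfolding H3_def by (simp add: limI)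
qed

lemma diam_pow_le:
  assumes "0 \<le> s" "s < t" "0 < e" "ediam A \<le> ennreal e"
  shows "diam_pow t A \<le> ennreal (e powr (t - s)) * diam_pow s A"
proof -
  have b: "bounded A"
    using assms(4) by (auto simp: ediam_def top_unique split: if_splits)
  have d: "0 \<le> diameter A" "diameter A \<le> e"
    using b assms by (auto simp: ediam_def diameter_ge_0 ennreal_le_iff)
  have "diameter A powr t = diameter A powr (t - s) * diameter A powr s"
    by (simp add: powr_add[symmetric])
  also have "\<dots> \<le> e powr (t - s) * diameter A powr s"
    using d assms by (intro mult_right_mono powr_mono2) auto
  finally have 1: "diameter A powr t \<le> e powr (t - s) * diameter A powr s" .
  have 2: "diameter A powr t \<le> e powr t"
    using d assms by (intro powr_mono2) auto
  show ?thesis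
    using 1 2 b assms by (auto simp: diam_pow_def ennreal_mult'[symmetric] intro!: ennreal_leI)
qed

lemma level_sum_le:
  assumes "0 \<le> s" "s < t" "0 < e" "mesh F L \<le> ennreal e"
  shows "level_sum t F L \<le> ennreal (e powr (t - s)) * level_sum s F L"
proof -
  let ?J = "{i \<in> fst L. snd L i \<inter> F \<noteq> {}}"
  have "diam_pow t (snd L i) \<le> ennreal (e powr (t - s)) * diam_pow s (snd L i)" if "i \<in> ?J" for i
  proof (rule diam_pow_le[OF assms(1-3)])
    have "ediam (snd L i) \<le> mesh F L"
      using that unfolding mesh_def elems_def by (intro SUP_upper) auto
    then show "ediam (snd L i) \<le> ennreal e"
      using assms(4) by (rule order_trans)
  qed
  then have "level_sum t F L \<le> (\<Sum>\<^sub>\<infinity>i\<in>?J. ennreal (e powr (t - s)) * diam_pow s (snd L i))"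
    unfolding level_sum_def by (intro infsum_mono nonneg_summable_on_complete) auto
  also have "\<dots> = ennreal (e powr (t - s)) * level_sum s F L"
    unfolding level_sum_def
    by (subst (1 2) nonneg_infsum_complete)
       (auto simp: SUP_mult_left_ennreal sum_distrib_left[symmetric])
  finally show ?thesis .
qed

lemma H3_eq_0:
  assumes mesh: "(\<lambda>n. mesh F (\<Gamma> n)) \<longlonglongrightarrow> 0"
    and st: "0 \<le> s" "s < t" and fin: "H3 \<Gamma> s F \<noteq> \<infinity>"
  shows "H3 \<Gamma> t F = 0"
proof -
  have *: "H3 \<Gamma> t F \<le> ennreal (e powr (t - s)) * H3 \<Gamma> s F" if "e > 0" for e
  proof -
    have "\<forall>\<^sub>F n in sequentially. mesh F (\<Gamma> n) < ennreal e"
      using mesh that by (intro order_tendstoD) auto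
    then obtain N where N: "\<And>n. n \<ge> N \<Longrightarrow> mesh F (\<Gamma> n) < ennreal e"
      by (auto simp: eventually_sequentially)
    have "H3_pre \<Gamma> n t F \<le> ennreal (e powr (t - s)) * H3_pre \<Gamma> n s F" if "n \<ge> N" for n
    proof -
      let ?c = "ennreal (e powr (t - s))" and ?d = "ennreal (e powr (s - t))"
      have dc: "?d * ?c = 1"
        using \<open>e > 0\<close> by (simp add: ennreal_mult'[symmetric] powr_add[symmetric])
      have "?d * H3_pre \<Gamma> n t F \<le> H3_pre \<Gamma> n s F"
        unfolding H3_pre_def[of _ _ s]
      proof (intro INF_greatest)
        fix l assume l: "l \<in> {n..}"
        with that have "mesh F (\<Gamma> l) \<le> ennreal e"
          using N[of l] by (simp add: less_imp_le)
        then have "level_sum t F (\<Gamma> l) \<le> ?c * level_sum s F (\<Gamma> l)"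
          using \<open>e > 0\<close> st by (intro level_sum_le) auto
        moreover have "H3_pre \<Gamma> n t F \<le> level_sum t F (\<Gamma> l)"
          unfolding H3_pre_def using l by (rule INF_lower)
        ultimately have "?d * H3_pre \<Gamma> n t F \<le> ?d * (?c * level_sum s F (\<Gamma> l))"
          by (intro mult_left_mono) auto
        also have "\<dots> = level_sum s F (\<Gamma> l)"
          by (simp add: mult.assoc[symmetric] dc)
        finally show "?d * H3_pre \<Gamma> n t F \<le> level_sum s F (\<Gamma> l)" .
      qed
      then have "?c * (?d * H3_pre \<Gamma> n t F) \<le> ?c * H3_pre \<Gamma> n s F"
        by (intro mult_left_mono) auto
      also have "?c * (?d * H3_pre \<Gamma> n t F) = H3_pre \<Gamma> n t F"
        using dc by (simp add: mult.assoc[symmetric] mult.commute[of ?c])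
      finally show ?thesis .
    qed
    then show ?thesis
      by (intro tendsto_le[OF _ ennreal_tendsto_cmult[OF _ H3_tendsto] H3_tendsto])
         (auto simp: eventually_sequentially)
  qed
  obtain M where M: "H3 \<Gamma> s F = ennreal M" "M \<ge> 0"
    using fin by (cases "H3 \<Gamma> s F") auto
  have small: "H3 \<Gamma> t F \<le> 0 + ennreal d" if "d > 0" for d
  proof -
    define e where "e = (d / (M + 1)) powr (1 / (t - s))"
    have e: "e > 0" "e powr (t - s) = d / (M + 1)"
      using that M st by (auto simp: e_def powr_powr)
    have "H3 \<Gamma> t F \<le> ennreal (d / (M + 1) * M)"
      using *[OF e(1)] M that unfolding e(2) M(1) by (subst ennreal_mult) auto
    also have "\<dots> \<le> ennreal d"
      using M that by (intro ennreal_leI) (simp add: field_simps)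
    finally show ?thesis by simp
  qed
  have "H3 \<Gamma> t F \<le> 0"
    by (rule ennreal_le_epsilon) (rule small)
  then show ?thesis by simp
qed

lemma dim3_eq_Sup:
  assumes mesh: "(\<lambda>n. mesh F (\<Gamma> n)) \<longlonglongrightarrow> 0"
  shows "dim3 \<Gamma> F = Sup {ennreal s |s. 0 \<le> s \<and> H3 \<Gamma> s F = \<infinity>}"
proof (rule antisym)
  let ?S = "Sup {ennreal s |s. 0 \<le> s \<and> H3 \<Gamma> s F = \<infinity>}"
  show "?S \<le> dim3 \<Gamma> F"
    unfolding dim3_def
  proof (intro Sup_least Inf_greatest)
    fix x y
    assume "x \<in> {ennreal s |s. 0 \<le> s \<and> H3 \<Gamma> s F = \<infinity>}"
      and "y \<in> {ennreal s |s. 0 \<le> s \<and> H3 \<Gamma> s F = 0}"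
    then obtain s t where st: "x = ennreal s" "0 \<le> s" "H3 \<Gamma> s F = \<infinity>"
        "y = ennreal t" "0 \<le> t" "H3 \<Gamma> t F = 0" by auto
    have "\<not> t < s" using H3_eq_0[OF mesh, of t s] st by auto
    then show "x \<le> y" using st by (auto intro: ennreal_leI)
  qed
  show "dim3 \<Gamma> F \<le> ?S"
  proof (rule ccontr)
    assume "\<not> dim3 \<Gamma> F \<le> ?S"
    then have "?S < dim3 \<Gamma> F" by (simp only: not_le)
    from dense[OF this] obtain x where x: "?S < x" "x < dim3 \<Gamma> F"
      by (elim exE conjE) (rule that)
    from dense[OF x(2)] obtain y where y: "x < y" "y < dim3 \<Gamma> F"
      by (elim exE conjE) (rule that)
    obtain s where s: "x = ennreal s" "s \<ge> 0"
      using y by (cases x) auto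
    obtain t where t: "y = ennreal t" "t \<ge> 0"
      using y by (cases y) auto
    have "H3 \<Gamma> s F \<noteq> \<infinity>"
    proof
      assume "H3 \<Gamma> s F = \<infinity>"
      then have "ennreal s \<le> ?S" using s by (intro Sup_upper) auto
      then show False using x s by simp
    qed
    moreover have "s < t" using y s t by (simp add: ennreal_less_iff)
    ultimately have "H3 \<Gamma> t F = 0" using H3_eq_0[OF mesh, of s t] s by auto
    then have "dim3 \<Gamma> F \<le> ennreal t"
      unfolding dim3_def using t by (intro Inf_lower) auto
    then show False using y t by simp
  qed
qed

lemma word_map_append: "word_map f (u @ v) = word_map f u \<circ> word_map f v"
  by (induction u) auto

lemma natural_fractal_structure_is_fractal_structure:
  assumes "is_attractor k f K"
  shows "fractal_structure K (natural_fractal_structure k f K)"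
proof -
  let ?W = "\<lambda>n. {w. length w = n \<and> set w \<subseteq> {1..k}}"
  have K: "K = (\<Union>i\<in>{1..k}. f i ` K)"
    using assms by (simp add: is_attractor_def)
  have el: "elems (natural_fractal_structure k f K n) = (\<lambda>w. word_map f w ` K) ` ?W n" for n
    by (simp add: elems_def natural_fractal_structure_def)
  have snoc: "word_map f (u @ [i]) ` K \<subseteq> word_map f u ` K" if "i \<in> {1..k}" for u i
  proof -
    have "f i ` K \<subseteq> K" using K that by blast
    then show ?thesis by (auto simp: word_map_append)
  qed
  have split: "word_map f u ` K = (\<Union>i\<in>{1..k}. word_map f (u @ [i]) ` K)" for u
  proof -
    have "word_map f u ` K = word_map f u ` (\<Union>i\<in>{1..k}. f i ` K)"
      using K by simp
    also have "\<dots> = (\<Union>i\<in>{1..k}. word_map f (u @ [i]) ` K)"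
      by (simp add: image_UN word_map_append image_comp)
    finally show ?thesis .
  qed
  have W: "?W (Suc n) = {u @ [i] |u i. u \<in> ?W n \<and> i \<in> {1..k}}" for n
  proof safe
    fix w :: "nat list" assume w: "length w = Suc n" "set w \<subseteq> {1..k}"
    then obtain u i where "w = u @ [i]" by (metis append_butlast_last_id length_0_conv nat.distinct(1))
    with w show "\<exists>u i. w = u @ [i] \<and> u \<in> ?W n \<and> i \<in> {1..k}" by auto
  qed auto
  have cov: "\<Union>((\<lambda>w. word_map f w ` K) ` ?W n) = K" for n
  proof (induction n)
    case 0
    have "?W 0 = {[]}" by auto
    then show ?case by simp
  next
    case (Suc n)
    have "\<Union>((\<lambda>w. word_map f w ` K) ` ?W (Suc n)) =
        (\<Union>u\<in>?W n. \<Union>i\<in>{1..k}. word_map f (u @ [i]) ` K)"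
      unfolding W by blast
    also have "\<dots> = (\<Union>u\<in>?W n. word_map f u ` K)"
      by (simp only: split[symmetric])
    finally show ?case using Suc by simp
  qed
  have ref: "\<exists>B\<in>(\<lambda>w. word_map f w ` K) ` ?W n. A \<subseteq> B"
    if A: "A \<in> (\<lambda>w. word_map f w ` K) ` ?W (Suc n)" for A n
  proof -
    obtain w where w: "w \<in> ?W (Suc n)" "A = word_map f w ` K" using A by (elim imageE)
    have "\<exists>u i. w = u @ [i] \<and> u \<in> ?W n \<and> i \<in> {1..k}"
      using w(1) unfolding W by (rule CollectD)
    then obtain u i where ui: "w = u @ [i]" "u \<in> ?W n" "i \<in> {1..k}"
      by (elim exE conjE) (rule that)
    have "A \<subseteq> word_map f u ` K" using snoc[OF ui(3)] w(2) ui(1) by simp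
    with ui(2) show ?thesis by (intro bexI[of _ "word_map f u ` K"] imageI)
  qed
  have uni: "B = \<Union>{A \<in> (\<lambda>w. word_map f w ` K) ` ?W (Suc n). A \<subseteq> B}"
    if B: "B \<in> (\<lambda>w. word_map f w ` K) ` ?W n" for B n
  proof -
    obtain u where u: "u \<in> ?W n" "B = word_map f u ` K" using B by (elim imageE)
    have mem: "word_map f (u @ [i]) ` K \<in> {A \<in> (\<lambda>w. word_map f w ` K) ` ?W (Suc n). A \<subseteq> B}"
      if "i \<in> {1..k}" for i
    proof (intro CollectI conjI imageI)
      show "length (u @ [i]) = Suc n" "set (u @ [i]) \<subseteq> {1..k}"
        using u(1) that by simp_all
      show "word_map f (u @ [i]) ` K \<subseteq> B" using snoc[OF that] u(2) by simp
    qed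
    have "(\<Union>i\<in>{1..k}. word_map f (u @ [i]) ` K)
        \<subseteq> \<Union>{A \<in> (\<lambda>w. word_map f w ` K) ` ?W (Suc n). A \<subseteq> B}"
      by (rule UN_least, rule Union_upper, rule mem)
    then have "B \<subseteq> \<Union>{A \<in> (\<lambda>w. word_map f w ` K) ` ?W (Suc n). A \<subseteq> B}"
      unfolding u(2) split[of u, symmetric] .
    then show ?thesis
    proof (rule equalityI)
      show "\<Union>{A \<in> (\<lambda>w. word_map f w ` K) ` ?W (Suc n). A \<subseteq> B} \<subseteq> B"
        by (rule Union_least) (elim CollectE conjE)
    qed
  qed
  show ?thesis
    unfolding fractal_structure_def el
    by (intro allI conjI ballI; (rule cov | erule ref | erule uni))
qed

lemma mesh_natural_fractal_structure:
  assumes ifs: "contractive_ifs k f c" and K: "is_attractor k f K"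
  shows "(\<lambda>n. mesh K (natural_fractal_structure k f K n)) \<longlonglongrightarrow> 0"
proof -
  have comp: "compact K" and "k \<noteq> 0"
    using K by (auto simp: is_attractor_def)
  define q where "q = Max (c ` {1..k})"
  have cq: "c i \<le> q" "0 < c i" if "i \<in> {1..k}" for i
    using ifs that by (auto simp: q_def contractive_ifs_def similarity_def)
  have "q \<in> c ` {1..k}" unfolding q_def using \<open>k \<noteq> 0\<close> by (intro Max_in) auto
  then have q: "0 < q" "q < 1"
    using ifs by (auto simp: contractive_ifs_def similarity_def)
  have lip: "dist (word_map f w x) (word_map f w y) \<le> q ^ length w * dist x y"
    if "set w \<subseteq> {1..k}" for w x y
    using that
  proof (induction w)
    case (Cons i w)
    have i: "i \<in> {1..k}" using Cons.prems by auto
    have "dist (word_map f (i # w) x) (word_map f (i # w) y)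
        = c i * dist (word_map f w x) (word_map f w y)"
      using ifs i by (simp add: contractive_ifs_def similarity_def)
    also have "\<dots> \<le> q * (q ^ length w * dist x y)"
      using Cons cq[OF i] q by (intro mult_mono) auto
    finally show ?case by (simp add: mult.assoc)
  qed simp
  have bd: "ediam (word_map f w ` K) \<le> ennreal (q ^ length w * diameter K)"
    if "set w \<subseteq> {1..k}" for w
  proof -
    have le: "dist x y \<le> q ^ length w * diameter K"
      if xy: "x \<in> word_map f w ` K" "y \<in> word_map f w ` K" for x y
    proof -
      obtain a b where ab: "a \<in> K" "b \<in> K" "x = word_map f w a" "y = word_map f w b"
        using xy by auto
      have "dist x y \<le> q ^ length w * dist a b"
        using lip[OF \<open>set w \<subseteq> {1..k}\<close>] ab by simp
      also have "\<dots> \<le> q ^ length w * diameter K"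
        using ab q comp by (intro mult_left_mono diameter_bounded_bound compact_imp_bounded) auto
      finally show ?thesis .
    qed
    have "bounded (word_map f w ` K)"
      using le unfolding bounded_two_points by blast
    moreover have "diameter (word_map f w ` K) \<le> q ^ length w * diameter K"
      using le K unfolding diameter_def is_attractor_def by (auto intro!: cSUP_least)
    ultimately show ?thesis by (simp add: ediam_def ennreal_leI)
  qed
  have le: "mesh K (natural_fractal_structure k f K n) \<le> ennreal (q ^ n * diameter K)" for n
    unfolding mesh_def elems_def natural_fractal_structure_def
    using bd by (intro SUP_least) auto
  have "(\<lambda>n. ennreal (q ^ n * diameter K)) \<longlonglongrightarrow> ennreal (0 * diameter K)"
    using q by (intro tendsto_ennrealI tendsto_mult LIMSEQ_power_zero tendsto_const) auto
  then have "(\<lambda>n. ennreal (q ^ n * diameter K)) \<longlonglongrightarrow> 0"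
    by simp
  then show ?thesis
    by (rule tendsto_sandwich[OF _ _ tendsto_const, rotated 2]) (simp_all add: le)
qed

end

theory Submission
  imports Defs
begin

text \<open>
  Every set of the natural fractal structure is a similar copy of the attractor: the set of
  the word \<open>w\<close> has diameter \<open>c\<^sub>w * diam K\<close>, where \<open>c\<^sub>w\<close> is the product of the ratios of the
  letters of \<open>w\<close>. A level is indexed by all words of length \<open>n\<close>, so expanding
  \<open>(\<Sum>i. c\<^sub>i\<^sup>t)\<^sup>n\<close> into a sum over words shows that the sum of \<open>diam(A)\<^sup>t\<close> over level \<open>n\<close> is exactly
  \<open>(\<Sum>i. c\<^sub>i\<^sup>t)\<^sup>n * diam(K)\<^sup>t\<close> (lemma \<open>level_sum_natural_fractal_structure\<close>).
  Overlaps between the pieces leave these sums unchanged, because a level counts words with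
  multiplicity and dimension III admits whole levels as its only coverings.

  For the solution \<open>s\<close> of the Moran equation these sums do not depend on the level,
  so \<open>H3\<close> takes the value \<open>diam(K)\<^sup>s\<close>. This value is finite because \<open>K\<close> is compact. It is positive
  when \<open>K\<close> has two points, and also when \<open>s = 0\<close> by the convention \<open>diam(K)\<^sup>0 = 1\<close>;
  the latter is the case of a single map, whose attractor is a point. An exponent at which
  \<open>H3\<close> is positive and finite is the dimension, since \<open>H3\<close> can be finite and
  nonzero at one exponent only (lemma \<open>dim3_eqI\<close>).
\<close>

section \<open>The Moran equation\<close>

lemma sum_powr_strict_antimono:
  fixes c :: "'i \<Rightarrow> real"
  assumes "finite I" "I \<noteq> {}" "\<And>i. i \<in> I \<Longrightarrow> 0 < c i \<and> c i < 1" "s < t"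
  shows "(\<Sum>i\<in>I. c i powr t) < (\<Sum>i\<in>I. c i powr s)"
  using assms by (intro sum_strict_mono powr_less_mono') auto

lemma Moran_solution_nonneg:
  fixes c :: "'i \<Rightarrow> real"
  assumes I: "finite I" "I \<noteq> {}" and c: "\<And>i. i \<in> I \<Longrightarrow> 0 < c i \<and> c i < 1"
    and s: "(\<Sum>i\<in>I. c i powr s) = 1"
  shows "0 \<le> s"
proof (rule ccontr)
  assume "\<not> 0 \<le> s"
  then have "(\<Sum>i\<in>I. c i powr 0) < (\<Sum>i\<in>I. c i powr s)"
    using I c by (intro sum_powr_strict_antimono) auto
  moreover have "(\<Sum>i\<in>I. c i powr 0) = (\<Sum>i\<in>I. 1)"
    using c by (intro sum.cong) force+
  moreover have "card I \<ge> 1"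
    using I by (simp add: Suc_le_eq card_gt_0_iff)
  ultimately show False using s by simp
qed

text \<open>
  The sum is strictly decreasing in the exponent and continuous, is \<open>card I \<ge> 1\<close> at
  exponent \<open>0\<close>, and tends to \<open>0\<close>; so it takes the value \<open>1\<close> exactly once.
\<close>

lemma Moran_equation_unique_solution:
  fixes c :: "'i \<Rightarrow> real"
  assumes I: "finite I" "I \<noteq> {}" and c: "\<And>i. i \<in> I \<Longrightarrow> 0 < c i \<and> c i < 1"
  shows "\<exists>!s. (\<Sum>i\<in>I. c i powr s) = 1"
proof -
  let ?\<phi> = "\<lambda>s. \<Sum>i\<in>I. c i powr s"
  have "((\<lambda>n. c i powr real n) \<longlonglongrightarrow> 0)" if "i \<in> I" for i
    using c[OF that] by (simp add: powr_realpow LIMSEQ_power_zero)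
  then have "(\<lambda>n. ?\<phi> (real n)) \<longlonglongrightarrow> (\<Sum>i\<in>I. 0)"
    by (intro tendsto_sum)
  then have "\<forall>\<^sub>F n in sequentially. ?\<phi> (real n) < 1"
    by (intro order_tendstoD) auto
  then obtain n :: nat where n: "?\<phi> (real n) < 1"
    by (auto simp: eventually_sequentially)
  have "?\<phi> 0 = (\<Sum>i\<in>I. 1)"
    using c by (intro sum.cong) force+
  moreover have "card I \<ge> 1"
    using I by (simp add: Suc_le_eq card_gt_0_iff)
  ultimately have "?\<phi> 0 \<ge> 1" by simp
  moreover have "continuous_on {0..real n} ?\<phi>"
    using c by (intro continuous_intros) force
  ultimately obtain s where s: "?\<phi> s = 1"
    using IVT2'[of ?\<phi> "real n" 1 0] n by auto
  have mono: "?\<phi> v < ?\<phi> u" if "u < v" for u v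
    using I c that by (intro sum_powr_strict_antimono) auto
  show ?thesis
  proof (rule ex1I[of _ s])
    fix t assume "?\<phi> t = 1"
    with s show "t = s"
      using mono[of s t] mono[of t s] by (cases s t rule: linorder_cases) auto
  qed (rule s)
qed

section \<open>Sums over words\<close>

lemma words_Suc:
  "{w. length w = Suc n \<and> set w \<subseteq> A} =
     (\<lambda>(i, w). i # w) ` (A \<times> {w. length w = n \<and> set w \<subseteq> A})"
  by (force simp: length_Suc_conv)

text \<open>The distributive law: the sum over all words expands the \<open>n\<close>-fold product.\<close>

lemma sum_words_prod_list:
  fixes g :: "'i \<Rightarrow> 'b::comm_semiring_1"
  shows "(\<Sum>w\<in>{w. length w = n \<and> set w \<subseteq> A}. prod_list (map g w)) = (\<Sum>i\<in>A. g i) ^ n"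
proof (induction n)
  case 0
  have "{w. length w = 0 \<and> set w \<subseteq> A} = {[]}" by auto
  then show ?case by simp
next
  case (Suc n)
  let ?W = "{w. length w = n \<and> set w \<subseteq> A}"
  have "inj_on (\<lambda>(i, w). i # w) (A \<times> ?W)"
    by (auto intro: inj_onI)
  then have "(\<Sum>w\<in>{w. length w = Suc n \<and> set w \<subseteq> A}. prod_list (map g w)) =
      (\<Sum>(i, w)\<in>A \<times> ?W. g i * prod_list (map g w))"
    unfolding words_Suc by (simp add: sum.reindex case_prod_unfold)
  also have "\<dots> = (\<Sum>i\<in>A. g i) * (\<Sum>w\<in>?W. prod_list (map g w))"
    by (simp add: sum_product sum.cartesian_product)
  finally show ?case using Suc by simp
qed

lemma prod_list_pos:
  fixes c :: "'i \<Rightarrow> real"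
  assumes "\<And>i. i \<in> set w \<Longrightarrow> 0 < c i"
  shows "0 < prod_list (map c w)"
  using assms by (induction w) auto

lemma prod_list_powr:
  fixes c :: "'i \<Rightarrow> real"
  assumes "\<And>i. i \<in> set w \<Longrightarrow> 0 < c i"
  shows "prod_list (map c w) powr s = prod_list (map (\<lambda>i. c i powr s) w)"
  using assms
proof (induction w)
  case (Cons i w)
  then show ?case
    using prod_list_pos[of w c] by (simp add: powr_mult less_imp_le)
qed simp

section \<open>Similar copies and their diameters\<close>

lemma similarity_word_map:
  assumes "\<And>i. i \<in> set w \<Longrightarrow> similarity (c i) (f i)"
  shows "similarity (prod_list (map c w)) (word_map f w)"
  using assms by (induction w) (auto simp: similarity_def mult.assoc)

lemma bounded_similarity_image:
  assumes "similarity r g" "bounded S"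
  shows "bounded (g ` S)"
proof -
  from assms obtain x e where e: "\<forall>y\<in>S. dist x y \<le> e"
    unfolding bounded_def by blast
  then have "\<forall>y\<in>S. dist (g x) (g y) \<le> r * e"
    using assms by (auto simp: similarity_def)
  then show ?thesis unfolding bounded_def by blast
qed

lemma diameter_similarity_image:
  assumes g: "similarity r g" and S: "bounded S" "S \<noteq> {}"
  shows "diameter (g ` S) = r * diameter S"
proof (rule antisym)
  have r: "r > 0" "\<And>x y. dist (g x) (g y) = r * dist x y"
    using g by (auto simp: similarity_def)
  have "dist x y \<le> diameter S" if "x \<in> S" "y \<in> S" for x y
    using S that by (intro diameter_bounded_bound) auto
  then show "diameter (g ` S) \<le> r * diameter S"
    using S r unfolding diameter_def[of "g ` S"] by (auto intro!: cSUP_least)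
  have "r * dist x y \<le> diameter (g ` S)" if "x \<in> S" "y \<in> S" for x y
    using diameter_bounded_bound[OF bounded_similarity_image[OF g S(1)], of "g x" "g y"] that r
    by simp
  then have "dist x y \<le> diameter (g ` S) / r" if "x \<in> S" "y \<in> S" for x y
    using r that by (simp add: field_simps)
  then have "diameter S \<le> diameter (g ` S) / r"
    using S unfolding diameter_def[of S] by (auto intro!: cSUP_least)
  then show "r * diameter S \<le> diameter (g ` S)"
    using r by (simp add: field_simps)
qed

lemma diam_pow_similarity_image:
  assumes g: "similarity r g" and S: "bounded S" "S \<noteq> {}"
  shows "diam_pow s (g ` S) = ennreal (r powr s) * diam_pow s S"
proof -
  have "r > 0" using g by (simp add: similarity_def)
  then show ?thesis
    using diameter_ge_0[OF S(1)] S bounded_similarity_image[OF g S(1)]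
    by (simp add: diam_pow_def diameter_similarity_image[OF g S] powr_mult ennreal_mult')
qed

lemma diam_pow_pos_finite:
  assumes "bounded S" "S \<noteq> {}" "s = 0 \<or> \<not> (\<exists>x. S = {x})"
  shows "0 < diam_pow s S \<and> diam_pow s S < \<infinity>"
proof (cases "s = 0")
  case False
  then obtain x y where xy: "x \<in> S" "y \<in> S" "x \<noteq> y"
    using assms by blast
  then have "0 < dist x y" "dist x y \<le> diameter S"
    using assms(1) by (auto intro: diameter_bounded_bound)
  then have "0 < diameter S" by linarith
  with False assms(1) show ?thesis
    by (simp add: diam_pow_def)
qed (simp add: diam_pow_def)

section \<open>Level sums and dimension III\<close>

text \<open>
  All words contribute, since every piece is a non-empty part of the attractor, and the
  contribution of a word is multiplicative in its letters.
\<close>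

lemma level_sum_natural_fractal_structure:
  assumes ifs: "contractive_ifs k f c" and K: "is_attractor k f K"
  shows "level_sum s K (natural_fractal_structure k f K n) =
    ennreal ((\<Sum>i\<in>{1..k}. c i powr s) ^ n) * diam_pow s K"
proof -
  let ?W = "{w. length w = n \<and> set w \<subseteq> {1..k}}"
  let ?L = "natural_fractal_structure k f K n"
  have bK: "bounded K" "K \<noteq> {}"
    using K by (auto simp: is_attractor_def compact_imp_bounded)
  have sim: "similarity (c i) (f i)" and c: "0 < c i" if "i \<in> {1..k}" for i
    using ifs that by (auto simp: contractive_ifs_def similarity_def)
  have L: "fst ?L = ?W" "\<And>w. snd ?L w = word_map f w ` K"
    by (simp_all add: natural_fractal_structure_def)
  have "word_map f w ` K \<subseteq> K" if "w \<in> ?W" for w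
  proof -
    have "\<Union>(elems ?L) = K"
      using natural_fractal_structure_is_fractal_structure[OF K]
      by (simp add: fractal_structure_def)
    then show ?thesis using that unfolding elems_def L by blast
  qed
  then have index: "{w \<in> fst ?L. snd ?L w \<inter> K \<noteq> {}} = ?W"
    using bK unfolding L by blast
  have summand: "diam_pow s (word_map f w ` K) =
      ennreal (prod_list (map (\<lambda>i. c i powr s) w)) * diam_pow s K" if w: "w \<in> ?W" for w
  proof -
    have "similarity (prod_list (map c w)) (word_map f w)"
      using w by (intro similarity_word_map sim) auto
    moreover have "prod_list (map c w) powr s = prod_list (map (\<lambda>i. c i powr s) w)"
      using w by (intro prod_list_powr c) auto
    ultimately show ?thesis
      by (simp add: diam_pow_similarity_image bK)
  qed
  have fin: "finite ?W"
    using finite_lists_length_eq[of "{1..k}" n] by (simp add: conj_commute)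
  have nonneg: "0 \<le> prod_list (map (\<lambda>i. c i powr s) w)" for w
    by (induction w) auto
  have "level_sum s K ?L = (\<Sum>w\<in>?W. diam_pow s (word_map f w ` K))"
    unfolding level_sum_def index by (simp only: L(2) infsum_finite[OF fin])
  also have "\<dots> = (\<Sum>w\<in>?W. ennreal (prod_list (map (\<lambda>i. c i powr s) w)) * diam_pow s K)"
    by (intro sum.cong refl summand)
  also have "\<dots> = ennreal (\<Sum>w\<in>?W. prod_list (map (\<lambda>i. c i powr s) w)) * diam_pow s K"
    by (simp add: sum_distrib_right[symmetric] sum_ennreal nonneg)
  finally show ?thesis
    unfolding sum_words_prod_list .
qed

lemma H3_const:
  assumes "\<And>n. level_sum s F (\<Gamma> n) = a"
  shows "H3 \<Gamma> s F = a"
proof -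
  have "H3_pre \<Gamma> n s F = a" for n
    unfolding H3_pre_def assms by simp
  then show ?thesis by (simp add: H3_def)
qed

text \<open>
  Finiteness at \<open>s\<close> makes \<open>H3\<close> vanish at every larger exponent; and if it vanished at a
  smaller exponent, the same jump would make it vanish at \<open>s\<close>.
\<close>

lemma dim3_eqI:
  assumes mesh: "(\<lambda>n. mesh F (\<Gamma> n)) \<longlonglongrightarrow> 0" and s: "0 \<le> s"
    and pos: "0 < H3 \<Gamma> s F" and fin: "H3 \<Gamma> s F < \<infinity>"
  shows "dim3 \<Gamma> F = ennreal s"
proof (rule antisym)
  show "ennreal s \<le> dim3 \<Gamma> F"
    unfolding dim3_def
  proof (rule Inf_greatest)
    fix x assume "x \<in> {ennreal t |t. 0 \<le> t \<and> H3 \<Gamma> t F = 0}"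
    then obtain t where t: "x = ennreal t" "0 \<le> t" "H3 \<Gamma> t F = 0" by auto
    then have "\<not> t < s"
      using H3_eq_0[OF mesh, of t s] pos by auto
    with t show "ennreal s \<le> x" by (simp add: ennreal_leI)
  qed
  show "dim3 \<Gamma> F \<le> ennreal s"
  proof (rule ennreal_le_epsilon)
    fix e :: real assume e: "0 < e"
    have "H3 \<Gamma> (s + e) F = 0"
      using H3_eq_0[OF mesh s, of "s + e"] e fin by auto
    then have "dim3 \<Gamma> F \<le> ennreal (s + e)"
      unfolding dim3_def using s e by (intro Inf_lower CollectI exI[of _ "s + e"]) simp
    then show "dim3 \<Gamma> F \<le> ennreal s + ennreal e"
      using s e by simp
  qed
qed

theorem theorem3p2:
  fixes f :: "nat \<Rightarrow> 'a::complete_space \<Rightarrow> 'a"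
    and c :: "nat \<Rightarrow> real" and k :: nat and K :: "'a set"
  assumes "contractive_ifs k f c"
    and "is_attractor k f K"
    and "k \<ge> 2 \<Longrightarrow> \<not> (\<exists>x. K = {x})"
  shows "(\<exists>!s. (\<Sum>i\<in>{1..k}. c i powr s) = 1) \<and>
    (\<forall>s. (\<Sum>i\<in>{1..k}. c i powr s) = 1 \<longrightarrow>
      0 \<le> s \<and>
      dim3 (natural_fractal_structure k f K) K = ennreal s \<and>
      0 < H3 (natural_fractal_structure k f K) s K \<and>
      H3 (natural_fractal_structure k f K) s K < \<infinity>)"
proof -
  let ?\<Gamma> = "natural_fractal_structure k f K"
  have bK: "bounded K" "K \<noteq> {}"
    using assms(2) by (auto simp: is_attractor_def compact_imp_bounded)
  \<comment> \<open>The empty system has no attractor: the union of its images is empty.\<close>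
  have "k \<noteq> 0"
    using assms(2) by (auto simp: is_attractor_def)
  then have I: "finite {1..k}" "{1..k} \<noteq> {}" by auto
  have c: "0 < c i \<and> c i < 1" if "i \<in> {1..k}" for i
    using assms(1) that by (auto simp: contractive_ifs_def similarity_def)
  have "0 \<le> s \<and> dim3 ?\<Gamma> K = ennreal s \<and> 0 < H3 ?\<Gamma> s K \<and> H3 ?\<Gamma> s K < \<infinity>"
    if s: "(\<Sum>i\<in>{1..k}. c i powr s) = 1" for s
  proof -
    have s0: "0 \<le> s"
      by (rule Moran_solution_nonneg[OF I c s])
    have H3: "H3 ?\<Gamma> s K = diam_pow s K"
      using level_sum_natural_fractal_structure[OF assms(1,2), of s] s
      by (intro H3_const) simp
    \<comment> \<open>A single ratio \<open>c\<^sub>1 < 1\<close> satisfies \<open>c\<^sub>1\<^sup>s = 1\<close> for \<open>s = 0\<close> only.\<close>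
    have "s = 0" if "k = 1"
      using s that c[of 1] by (simp add: powr_eq_one_iff_gen)
    then have "s = 0 \<or> \<not> (\<exists>x. K = {x})"
      using assms(3) \<open>k \<noteq> 0\<close> by (cases "k = 1") auto
    then have "0 < H3 ?\<Gamma> s K \<and> H3 ?\<Gamma> s K < \<infinity>"
      unfolding H3 by (rule diam_pow_pos_finite[OF bK])
    with s0 show ?thesis
      using dim3_eqI[OF mesh_natural_fractal_structure[OF assms(1,2)]] by blast
  qed
  moreover have "\<exists>!s. (\<Sum>i\<in>{1..k}. c i powr s) = 1"
    by (rule Moran_equation_unique_solution[OF I]) (rule c)
  ultimately show ?thesis
    by blast
qed

end
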